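(* (Pasting lemma) Let $X$ and $Y$ be limit spaces and let $f\colon X\to Y$ be a function. If $\mathcal{C}$ is a locally finite cover of $X$ by closed sets such that the restriction $f|_C\colon C\to Y$ is continuous for every $C\in\mathcal{C}$ (where $C$ carries the subspace convergence inherited from $X$), then $f$ is continuous.
   Context: **Nets.** A net in a set $X$ is a function $\varphi\colon\mathbb{D}\to X$ with $\mathbb{D}$ a (nonempty) directed preordered set. Its tail sets are $\varphi[a^\uparrow]=\{\varphi(b):b\succeq a\}$, $a\in\mathbb{D}$, and $\varphi^\uparrow$ denotes the proper filter of all subsets of $X$ containing a tail set of $\varphi$. Every proper filter on $X$ is of the form $\varphi^\uparrow$. **Limit spaces.** A preconvergence on $X$ is an assignment $L$ of a subset $L(\varphi)\subseteq X$ to each net $\varphi$ in $X$ such that $L(\varphi)=L(\psi)$ whenever $\varphi^\uparrow=\psi^\uparrow$ (equivalently, a function from proper filters on $X$ to subsets of $X$). One writes $\varphi\to_L x$ for $x\in L(\varphi)$. A limit space is a set $X$ with a preconvergence $L$ that is: centered (every constant net with value $x$ converges to $x$); isotone (if $\varphi^\uparrow\subseteq\psi^\uparrow$ then $L(\varphi)\subseteq L(\psi)$); and stable: $L(\varphi)\cap L(\psi)\subseteq L(\rho)$ whenever $\varphi,\psi,\rho\colon\mathbb{D}\to X$ are nets and there is $D\in\mathbb{D}$ with $\rho(d)\in\{\varphi(d),\psi(d)\}$ for all $d\succeq D$. (For isotone $L$, stability is equivalent to: $L(\mathcal{F})\cap L(\mathcal{G})\subseteq L(\mathcal{F}\cap\mathcal{G})$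 for all proper filters $\mathcal{F},\mathcal{G}$.) A function $f\colon X\to Y$ between limit spaces is continuous if $\varphi\to x$ in $X$ implies $f\circ\varphi\to f(x)$ in $Y$, for all nets $\varphi$ in $X$ and $x\in X$. A subset $C\subseteq X$ carries the subspace convergence: a net $\psi$ in $C$ converges to $x\in C$ in $C$ iff $\psi\to x$ in $X$. **Open, closed, locally finite.** A subset $O\subseteq X$ is open if every net $\varphi$ in $X$ that converges to some point of $O$ has a tail set contained in $O$; closed sets are the complements of open sets. The open sets form a topology on $X$. A family $\mathcal{C}$ of subsets of $X$ is locally finite if every $x\in X$ belongs to some open set $O\subseteq X$ such that $\{C\in\mathcal{C}:C\cap O\neq\emptyset\}$ is finite. *)

theory Defs
  imports "HOL-Library.FuncSet"
begin

definition directed_on :: "'i set \<Rightarrow> 'i rel \<Rightarrow> bool" where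
  "directed_on D r \<longleftrightarrow>
     D \<noteq> {} \<and> preorder_on D r \<and> (\<forall>a\<in>D. \<forall>b\<in>D. \<exists>c\<in>D. (a, c) \<in> r \<and> (b, c) \<in> r)"

definition net_in :: "'a set \<Rightarrow> 'i set \<Rightarrow> 'i rel \<Rightarrow> ('i \<Rightarrow> 'a) \<Rightarrow> bool" where
  "net_in X D r \<phi> \<longleftrightarrow> directed_on D r \<and> \<phi> \<in> D \<rightarrow> X"

definition tail :: "'i set \<Rightarrow> 'i rel \<Rightarrow> ('i \<Rightarrow> 'a) \<Rightarrow> 'i \<Rightarrow> 'a set" where
  "tail D r \<phi> a = \<phi> ` {b \<in> D. (a, b) \<in> r}"

(* A proper filter on the set X is a filter F on the ambient type with F \<noteq> bot and
   F \<le> principal X.  The order on filters is reverse inclusion, so that inclusion of the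
   tail filter of \<phi> in the tail filter of \<psi> reads
   tail_filter E s \<psi> \<le> tail_filter D r \<phi>. *)
definition tail_filter :: "'i set \<Rightarrow> 'i rel \<Rightarrow> ('i \<Rightarrow> 'a) \<Rightarrow> 'a filter" where
  "tail_filter D r \<phi> = (INF a\<in>D. principal (tail D r \<phi> a))"

(* A preconvergence depends on a net only through its tail filter and is therefore a function
   on filters; its values at filters that are not proper filters on X are irrelevant. *)
definition preconvergence :: "'a set \<Rightarrow> ('a filter \<Rightarrow> 'a set) \<Rightarrow> bool" where
  "preconvergence X L \<longleftrightarrow> (\<forall>F. F \<noteq> bot \<and> F \<le> principal X \<longrightarrow> L F \<subseteq> X)"

definition net_lim :: "('a filter \<Rightarrow> 'a set) \<Rightarrow> 'i set \<Rightarrow> 'i rel \<Rightarrow> ('i \<Rightarrow> 'a) \<Rightarrow> 'a set" where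
  "net_lim L D r \<phi> = L (tail_filter D r \<phi>)"

(* HOL cannot quantify over all index types inside a definition, so nets in a set of elements
   of type 'a are indexed by directed subsets of the following type.  It is large enough: by
   the lemmas at the end, every condition defined with it holds for nets over arbitrary index
   types. *)
type_synonym 'a net_index = "('a \<times> 'a set) \<times> ('a \<times> 'a set) \<times> bool"

definition centered :: "'a set \<Rightarrow> ('a filter \<Rightarrow> 'a set) \<Rightarrow> bool" where
  "centered X L \<longleftrightarrow>
     (\<forall>x\<in>X. \<forall>D r (\<phi> :: 'a net_index \<Rightarrow> 'a).
        directed_on D r \<and> (\<forall>d\<in>D. \<phi> d = x) \<longrightarrow> x \<in> net_lim L D r \<phi>)"

definition isotone :: "'a set \<Rightarrow> ('a filter \<Rightarrow> 'a set) \<Rightarrow> bool" where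
  "isotone X L \<longleftrightarrow>
     (\<forall>D r (\<phi> :: 'a net_index \<Rightarrow> 'a) E s (\<psi> :: 'a net_index \<Rightarrow> 'a).
        net_in X D r \<phi> \<and> net_in X E s \<psi> \<and> tail_filter E s \<psi> \<le> tail_filter D r \<phi>
        \<longrightarrow> net_lim L D r \<phi> \<subseteq> net_lim L E s \<psi>)"

definition stable :: "'a set \<Rightarrow> ('a filter \<Rightarrow> 'a set) \<Rightarrow> bool" where
  "stable X L \<longleftrightarrow>
     (\<forall>D r (\<phi> :: 'a net_index \<Rightarrow> 'a) \<psi> \<rho>.
        net_in X D r \<phi> \<and> net_in X D r \<psi> \<and> net_in X D r \<rho> \<and>
        (\<exists>a\<in>D. \<forall>d\<in>D. (a, d) \<in> r \<longrightarrow> \<rho> d \<in> {\<phi> d, \<psi> d})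
        \<longrightarrow> net_lim L D r \<phi> \<inter> net_lim L D r \<psi> \<subseteq> net_lim L D r \<rho>)"

definition limit_space :: "'a set \<Rightarrow> ('a filter \<Rightarrow> 'a set) \<Rightarrow> bool" where
  "limit_space X L \<longleftrightarrow> preconvergence X L \<and> centered X L \<and> isotone X L \<and> stable X L"

definition lim_continuous ::
    "'a set \<Rightarrow> ('a filter \<Rightarrow> 'a set) \<Rightarrow> 'b set \<Rightarrow> ('b filter \<Rightarrow> 'b set) \<Rightarrow> ('a \<Rightarrow> 'b) \<Rightarrow> bool" where
  "lim_continuous X L Y M f \<longleftrightarrow>
     f \<in> X \<rightarrow> Y \<and>
     (\<forall>D r (\<phi> :: 'a net_index \<Rightarrow> 'a). \<forall>x\<in>X.
        net_in X D r \<phi> \<and> x \<in> net_lim L D r \<phi> \<longrightarrow> f x \<in> net_lim M D r (f \<circ> \<phi>))"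

definition subspace_conv :: "'a set \<Rightarrow> ('a filter \<Rightarrow> 'a set) \<Rightarrow> 'a filter \<Rightarrow> 'a set" where
  "subspace_conv C L F = L F \<inter> C"

definition lim_open :: "'a set \<Rightarrow> ('a filter \<Rightarrow> 'a set) \<Rightarrow> 'a set \<Rightarrow> bool" where
  "lim_open X L U \<longleftrightarrow>
     U \<subseteq> X \<and>
     (\<forall>D r (\<phi> :: 'a net_index \<Rightarrow> 'a). \<forall>x\<in>U.
        net_in X D r \<phi> \<and> x \<in> net_lim L D r \<phi> \<longrightarrow> (\<exists>a\<in>D. tail D r \<phi> a \<subseteq> U))"

definition lim_closed :: "'a set \<Rightarrow> ('a filter \<Rightarrow> 'a set) \<Rightarrow> 'a set \<Rightarrow> bool" where
  "lim_closed X L C \<longleftrightarrow> C \<subseteq> X \<and> lim_open X L (X - C)"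

definition lim_locally_finite :: "'a set \<Rightarrow> ('a filter \<Rightarrow> 'a set) \<Rightarrow> 'a set set \<Rightarrow> bool" where
  "lim_locally_finite X L \<C> \<longleftrightarrow>
     \<C> \<subseteq> Pow X \<and> (\<forall>x\<in>X. \<exists>U. lim_open X L U \<and> x \<in> U \<and> finite {C \<in> \<C>. C \<inter> U \<noteq> {}})"


lemma eventually_tail_filter:
  assumes "directed_on D r"
  shows "eventually P (tail_filter D r \<phi>) \<longleftrightarrow> (\<exists>a\<in>D. \<forall>x\<in>tail D r \<phi> a. P x)"
proof -
  have "\<exists>c\<in>D. principal (tail D r \<phi> c) \<le> inf (principal (tail D r \<phi> a)) (principal (tail D r \<phi> b))"
    if ab: "a \<in> D" "b \<in> D" for a b
  proof -
    obtain c where c: "c \<in> D" "(a, c) \<in> r" "(b, c) \<in> r"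
      using assms ab by (auto simp: directed_on_def)
    moreover have "trans r"
      using assms by (auto simp: directed_on_def preorder_on_def)
    ultimately show ?thesis
      by (intro bexI[of _ c]) (auto simp: tail_def dest: transD)
  qed
  moreover have "D \<noteq> {}"
    using assms by (simp add: directed_on_def)
  ultimately show ?thesis
    unfolding tail_filter_def by (subst eventually_INF_base) (auto simp: eventually_principal)
qed

lemma tail_filter_proper:
  assumes "net_in X D r \<phi>"
  shows "tail_filter D r \<phi> \<noteq> bot" and "tail_filter D r \<phi> \<le> principal X"
proof -
  have D: "directed_on D r" and \<phi>: "\<phi> \<in> D \<rightarrow> X"
    using assms by (auto simp: net_in_def)
  have "a \<in> D \<Longrightarrow> \<phi> a \<in> tail D r \<phi> a" for a
    using D by (auto simp: tail_def directed_on_def preorder_on_def refl_on_def)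
  then show "tail_filter D r \<phi> \<noteq> bot"
    by (auto simp: trivial_limit_def eventually_tail_filter[OF D])
  show "tail_filter D r \<phi> \<le> principal X"
    using D \<phi> by (auto simp: le_principal eventually_tail_filter[OF D] tail_def directed_on_def)
qed

lemma tail_filter_comp:
  "directed_on D r \<Longrightarrow> tail_filter D r (f \<circ> \<phi>) = filtermap f (tail_filter D r \<phi>)"
  by (auto simp: filter_eq_iff eventually_filtermap eventually_tail_filter tail_def)

lemma ex_nets_of_filters:
  fixes F G :: "'a filter"
  assumes F: "F \<noteq> bot" "F \<le> principal X" and G: "G \<noteq> bot" "G \<le> principal X"
  obtains D r and \<phi> \<psi> \<rho> :: "'a net_index \<Rightarrow> 'a"
  where "net_in X D r \<phi>" "net_in X D r \<psi>" "net_in X D r \<rho>"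
    "\<And>d. \<rho> d \<in> {\<phi> d, \<psi> d}"
    "tail_filter D r \<phi> = F" "tail_filter D r \<psi> = G" "tail_filter D r \<rho> = sup F G"
proof -
  define P where "P H = {(x, A). x \<in> A \<and> A \<subseteq> X \<and> eventually (\<lambda>x. x \<in> A) H}" for H :: "'a filter"
  define D :: "'a net_index set" where "D = P F \<times> P G \<times> UNIV"
  define r :: "'a net_index rel" where
    "r = {(((x, A), (y, B), i), ((x', A'), (y', B'), i')) | x A y B i x' A' y' B' i'.
            ((x, A), (y, B), i) \<in> D \<and> ((x', A'), (y', B'), i') \<in> D \<and> A' \<subseteq> A \<and> B' \<subseteq> B}"
  define \<phi> :: "'a net_index \<Rightarrow> 'a" where "\<phi> = (\<lambda>(p, q, i). fst p)"
  define \<psi> :: "'a net_index \<Rightarrow> 'a" where "\<psi> = (\<lambda>(p, q, i). fst q)"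
  define \<rho> :: "'a net_index \<Rightarrow> 'a" where "\<rho> d = (if snd (snd d) then \<phi> d else \<psi> d)" for d
  have ne: "\<exists>x. (x, A) \<in> P H"
    if "H \<noteq> bot" "A \<subseteq> X" "eventually (\<lambda>x. x \<in> A) H" for H A
    using eventually_happens'[OF that(1,3)] that by (auto simp: P_def)
  have int: "eventually (\<lambda>x. x \<in> A \<inter> B) H"
    if "eventually (\<lambda>x. x \<in> A) H" "eventually (\<lambda>x. x \<in> B) H" for H :: "'a filter" and A B
    using eventually_conj[OF that] by simp
  have X: "eventually (\<lambda>x. x \<in> X) F" "eventually (\<lambda>x. x \<in> X) G"
    using F G by (auto simp: le_principal)
  have "D \<noteq> {}"
    using ne[OF F(1) _ X(1)] ne[OF G(1) _ X(2)] by (auto simp: D_def)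
  moreover have "preorder_on D r"
    by (auto simp: preorder_on_def refl_on_def r_def intro!: transI) blast+
  moreover have "\<exists>c\<in>D. (a, c) \<in> r \<and> (b, c) \<in> r" if ab: "a \<in> D" "b \<in> D" for a b
  proof -
    obtain x A y B i where a: "a = ((x, A), (y, B), i)" by (metis surj_pair)
    obtain x' A' y' B' i' where b: "b = ((x', A'), (y', B'), i')" by (metis surj_pair)
    obtain u where u: "(u, A \<inter> A') \<in> P F"
      using ne[of F "A \<inter> A'"] int[of A F A'] F(1) ab by (auto simp: a b D_def P_def)
    obtain v where v: "(v, B \<inter> B') \<in> P G"
      using ne[of G "B \<inter> B'"] int[of B G B'] G(1) ab by (auto simp: a b D_def P_def)
    show ?thesis
      by (rule bexI[of _ "((u, A \<inter> A'), (v, B \<inter> B'), True)"])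
        (use u v ab in \<open>auto simp: a b D_def r_def\<close>)
  qed
  ultimately have dir: "directed_on D r"
    by (auto simp: directed_on_def)
  have nets: "net_in X D r \<phi>" "net_in X D r \<psi>" "net_in X D r \<rho>"
    using dir by (auto simp: net_in_def D_def \<phi>_def \<psi>_def \<rho>_def P_def)
  have tails: "tail D r \<phi> ((x, A), (y, B), i) = A" "tail D r \<psi> ((x, A), (y, B), i) = B"
    "tail D r \<rho> ((x, A), (y, B), i) = A \<union> B"
    if "((x, A), (y, B), i) \<in> D" for x A y B i
  proof -
    have r: "(((x, A), (y, B), i), ((x', A), (y', B), j)) \<in> r" "((x', A), (y', B), j) \<in> D"
      if "x' \<in> A" "y' \<in> B" for x' y' j
      using that \<open>((x, A), (y, B), i) \<in> D\<close> by (auto simp: r_def D_def P_def)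
    have xy: "x \<in> A" "y \<in> B" using that by (auto simp: D_def P_def)
    have sub: "\<phi> d \<in> A" "\<psi> d \<in> B" if "(((x, A), (y, B), i), d) \<in> r" for d
      using that by (auto simp: r_def D_def P_def \<phi>_def \<psi>_def)
    show "tail D r \<phi> ((x, A), (y, B), i) = A"
    proof (intro equalityI subsetI)
      fix z assume "z \<in> A"
      then show "z \<in> tail D r \<phi> ((x, A), (y, B), i)"
        unfolding tail_def using r[of z y True] xy
        by (intro image_eqI[of _ _ "((z, A), (y, B), True)"]) (auto simp: \<phi>_def)
    qed (use sub in \<open>auto simp: tail_def\<close>)
    show "tail D r \<psi> ((x, A), (y, B), i) = B"
    proof (intro equalityI subsetI)
      fix z assume "z \<in> B"
      then show "z \<in> tail D r \<psi> ((x, A), (y, B), i)"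
        unfolding tail_def using r[of x z True] xy
        by (intro image_eqI[of _ _ "((x, A), (z, B), True)"]) (auto simp: \<psi>_def)
    qed (use sub in \<open>auto simp: tail_def\<close>)
    show "tail D r \<rho> ((x, A), (y, B), i) = A \<union> B"
    proof (intro equalityI subsetI)
      fix z assume "z \<in> A \<union> B"
      then show "z \<in> tail D r \<rho> ((x, A), (y, B), i)"
      proof
        assume "z \<in> A"
        then show ?thesis
          unfolding tail_def using r[of z y True] xy
          by (intro image_eqI[of _ _ "((z, A), (y, B), True)"]) (auto simp: \<rho>_def \<phi>_def)
      next
        assume "z \<in> B"
        then show ?thesis
          unfolding tail_def using r[of x z False] xy
          by (intro image_eqI[of _ _ "((x, A), (z, B), False)"]) (auto simp: \<rho>_def \<psi>_def)
      qed
    qed (use sub in \<open>auto simp: tail_def \<rho>_def\<close>)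
  qed
  have ex_index: "\<exists>x y. ((x, A), (y, B), True) \<in> D"
    if "A \<subseteq> X" "eventually (\<lambda>x. x \<in> A) F" "B \<subseteq> X" "eventually (\<lambda>x. x \<in> B) G" for A B
    using ne[OF F(1) that(1,2)] ne[OF G(1) that(3,4)] by (auto simp: D_def)
  have index: "eventually (\<lambda>x. x \<in> A) F" "eventually (\<lambda>x. x \<in> B) G"
    if "((x, A), (y, B), i) \<in> D" for x A y B i
    using that by (auto simp: D_def P_def)
  have evF: "eventually (\<lambda>x. x \<in> {x \<in> X. Q x}) F" if "eventually Q F" for Q
    using eventually_conj[OF X(1) that] by simp
  have evG: "eventually (\<lambda>x. x \<in> {x \<in> X. Q x}) G" if "eventually Q G" for Q
    using eventually_conj[OF X(2) that] by simp
  have "tail_filter D r \<phi> = F"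
    unfolding filter_eq_iff
  proof (intro allI iffI)
    fix Q assume "eventually Q F"
    from ex_index[OF _ evF[OF this] _ X(2)] obtain x y where
      ix: "((x, {x \<in> X. Q x}), (y, X), True) \<in> D" by auto
    then show "eventually Q (tail_filter D r \<phi>)"
      unfolding eventually_tail_filter[OF dir] using tails(1)[OF ix] by (intro bexI[OF _ ix]) simp
  next
    fix Q assume "eventually Q (tail_filter D r \<phi>)"
    then obtain a where a: "a \<in> D" "\<forall>x\<in>tail D r \<phi> a. Q x"
      by (auto simp: eventually_tail_filter[OF dir])
    obtain x A y B i where "a = ((x, A), (y, B), i)" by (metis surj_pair)
    with a show "eventually Q F"
      using index(1) tails(1) by (metis (mono_tags, lifting) eventually_mono)
  qed
  moreover have "tail_filter D r \<psi> = G"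
    unfolding filter_eq_iff
  proof (intro allI iffI)
    fix Q assume "eventually Q G"
    from ex_index[OF _ X(1) _ evG[OF this]] obtain x y where
      ix: "((x, X), (y, {x \<in> X. Q x}), True) \<in> D" by auto
    then show "eventually Q (tail_filter D r \<psi>)"
      unfolding eventually_tail_filter[OF dir] using tails(2)[OF ix] by (intro bexI[OF _ ix]) simp
  next
    fix Q assume "eventually Q (tail_filter D r \<psi>)"
    then obtain a where a: "a \<in> D" "\<forall>x\<in>tail D r \<psi> a. Q x"
      by (auto simp: eventually_tail_filter[OF dir])
    obtain x A y B i where "a = ((x, A), (y, B), i)" by (metis surj_pair)
    with a show "eventually Q G"
      using index(2) tails(2) by (metis (mono_tags, lifting) eventually_mono)
  qed
  moreover have "tail_filter D r \<rho> = sup F G"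
    unfolding filter_eq_iff
  proof (intro allI iffI)
    fix Q assume "eventually Q (sup F G)"
    then have Q: "eventually Q F" "eventually Q G" by (auto simp: eventually_sup)
    from ex_index[OF _ evF[OF Q(1)] _ evG[OF Q(2)]] obtain x y where
      ix: "((x, {x \<in> X. Q x}), (y, {x \<in> X. Q x}), True) \<in> D" by auto
    then show "eventually Q (tail_filter D r \<rho>)"
      unfolding eventually_tail_filter[OF dir] using tails(3)[OF ix] by (intro bexI[OF _ ix]) simp
  next
    fix Q assume "eventually Q (tail_filter D r \<rho>)"
    then obtain a where a: "a \<in> D" "\<forall>x\<in>tail D r \<rho> a. Q x"
      by (auto simp: eventually_tail_filter[OF dir])
    obtain x A y B i where ai: "a = ((x, A), (y, B), i)" by (metis surj_pair)
    have "\<forall>x\<in>A \<union> B. Q x" using a tails(3) ai by metis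
    then show "eventually Q (sup F G)"
      using index[of x A y B i] a(1) ai by (auto simp: eventually_sup elim!: eventually_mono)
  qed
  moreover have "\<rho> d \<in> {\<phi> d, \<psi> d}" for d by (simp add: \<rho>_def)
  ultimately show thesis using that nets by blast
qed

lemma ex_net_of_filter:
  fixes F :: "'a filter"
  assumes "F \<noteq> bot" "F \<le> principal X"
  obtains D r and \<phi> :: "'a net_index \<Rightarrow> 'a"
  where "net_in X D r \<phi>" "tail_filter D r \<phi> = F"
  using ex_nets_of_filters[OF assms assms] by metis

lemma isotone_iff_filter:
  "isotone X L \<longleftrightarrow>
     (\<forall>F G. F \<noteq> bot \<and> F \<le> principal X \<and> G \<noteq> bot \<and> G \<le> F \<longrightarrow> L F \<subseteq> L G)"
proof
  assume iso: "isotone X L"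
  show "\<forall>F G. F \<noteq> bot \<and> F \<le> principal X \<and> G \<noteq> bot \<and> G \<le> F \<longrightarrow> L F \<subseteq> L G"
  proof (intro allI impI, elim conjE)
    fix F G :: "'a filter"
    assume FG: "F \<noteq> bot" "F \<le> principal X" "G \<noteq> bot" "G \<le> F"
    obtain D r and \<phi> :: "'a net_index \<Rightarrow> 'a" where \<phi>: "net_in X D r \<phi>" "tail_filter D r \<phi> = F"
      using ex_net_of_filter[OF FG(1,2)] .
    obtain E s and \<psi> :: "'a net_index \<Rightarrow> 'a" where \<psi>: "net_in X E s \<psi>" "tail_filter E s \<psi> = G"
      using ex_net_of_filter[OF FG(3) order_trans[OF FG(4,2)]] .
    have "tail_filter E s \<psi> \<le> tail_filter D r \<phi>"
      using \<phi> \<psi> FG(4) by simp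
    then have "net_lim L D r \<phi> \<subseteq> net_lim L E s \<psi>"
      using iso \<phi>(1) \<psi>(1) unfolding isotone_def by blast
    then show "L F \<subseteq> L G"
      using \<phi>(2) \<psi>(2) by (simp add: net_lim_def)
  qed
next
  assume "\<forall>F G. F \<noteq> bot \<and> F \<le> principal X \<and> G \<noteq> bot \<and> G \<le> F \<longrightarrow> L F \<subseteq> L G"
  then show "isotone X L"
    unfolding isotone_def net_lim_def using tail_filter_proper by metis
qed

lemma tail_filter_le_sup:
  assumes "directed_on D r" "a \<in> D" "\<And>d. d \<in> D \<Longrightarrow> (a, d) \<in> r \<Longrightarrow> \<rho> d \<in> {\<phi> d, \<psi> d}"
  shows "tail_filter D r \<rho> \<le> sup (tail_filter D r \<phi>) (tail_filter D r \<psi>)"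
proof (rule filter_leI)
  fix Q assume "eventually Q (sup (tail_filter D r \<phi>) (tail_filter D r \<psi>))"
  then obtain b c where bc: "b \<in> D" "\<forall>x\<in>tail D r \<phi> b. Q x" "c \<in> D" "\<forall>x\<in>tail D r \<psi> c. Q x"
    by (auto simp: eventually_sup eventually_tail_filter[OF assms(1)])
  have up: "\<exists>z\<in>D. (x, z) \<in> r \<and> (y, z) \<in> r" if "x \<in> D" "y \<in> D" for x y
    using assms(1) that by (auto simp: directed_on_def)
  have tr: "trans r"
    using assms(1) by (auto simp: directed_on_def preorder_on_def)
  obtain u where u: "u \<in> D" "(a, u) \<in> r" "(b, u) \<in> r" using up assms(2) bc by blast
  obtain v where v: "v \<in> D" "(u, v) \<in> r" "(c, v) \<in> r" using up u bc by blast
  have "Q (\<rho> d)" if "d \<in> D" "(v, d) \<in> r" for d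
  proof -
    have "(a, d) \<in> r" "(b, d) \<in> r" "(c, d) \<in> r"
      using u v that tr by (meson transD)+
    then show ?thesis using assms(3)[of d] bc that by (auto simp: tail_def)
  qed
  with v(1) show "eventually Q (tail_filter D r \<rho>)"
    by (auto simp: eventually_tail_filter[OF assms(1)] tail_def)
qed

lemma stable_iff_filter:
  assumes "isotone X L"
  shows "stable X L \<longleftrightarrow>
     (\<forall>F G. F \<noteq> bot \<and> F \<le> principal X \<and> G \<noteq> bot \<and> G \<le> principal X \<longrightarrow> L F \<inter> L G \<subseteq> L (sup F G))"
proof
  assume st: "stable X L"
  show "\<forall>F G. F \<noteq> bot \<and> F \<le> principal X \<and> G \<noteq> bot \<and> G \<le> principal X
          \<longrightarrow> L F \<inter> L G \<subseteq> L (sup F G)"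
  proof (intro allI impI, elim conjE)
    fix F G :: "'a filter"
    assume FG: "F \<noteq> bot" "F \<le> principal X" "G \<noteq> bot" "G \<le> principal X"
    obtain D r and \<phi> \<psi> \<rho> :: "'a net_index \<Rightarrow> 'a" where
      nets: "net_in X D r \<phi>" "net_in X D r \<psi>" "net_in X D r \<rho>"
      and choice: "\<And>d. \<rho> d \<in> {\<phi> d, \<psi> d}"
      and filters: "tail_filter D r \<phi> = F" "tail_filter D r \<psi> = G" "tail_filter D r \<rho> = sup F G"
      using ex_nets_of_filters[OF FG] by metis
    have "\<exists>a. a \<in> D"
      using nets by (auto simp: net_in_def directed_on_def)
    then have "net_lim L D r \<phi> \<inter> net_lim L D r \<psi> \<subseteq> net_lim L D r \<rho>"
      using st nets choice unfolding stable_def by blast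
    then show "L F \<inter> L G \<subseteq> L (sup F G)"
      using filters by (simp add: net_lim_def)
  qed
next
  assume sup: "\<forall>F G. F \<noteq> bot \<and> F \<le> principal X \<and> G \<noteq> bot \<and> G \<le> principal X
                 \<longrightarrow> L F \<inter> L G \<subseteq> L (sup F G)"
  show "stable X L"
    unfolding stable_def
  proof (intro allI impI, elim conjE bexE)
    fix D r a and \<phi> \<psi> \<rho> :: "'a net_index \<Rightarrow> 'a"
    assume nets: "net_in X D r \<phi>" "net_in X D r \<psi>" "net_in X D r \<rho>"
      and a: "a \<in> D" "\<forall>d\<in>D. (a, d) \<in> r \<longrightarrow> \<rho> d \<in> {\<phi> d, \<psi> d}"
    let ?F = "tail_filter D r \<phi>" and ?G = "tail_filter D r \<psi>"
    note p = tail_filter_proper[OF nets(1)] tail_filter_proper[OF nets(2)]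
      tail_filter_proper[OF nets(3)]
    have "tail_filter D r \<rho> \<le> sup ?F ?G"
      using tail_filter_le_sup[of D r a \<rho> \<phi> \<psi>] nets(1) a by (auto simp: net_in_def)
    then have "L (sup ?F ?G) \<subseteq> L (tail_filter D r \<rho>)"
      using assms p unfolding isotone_iff_filter by (simp add: sup_eq_bot_iff)
    then show "net_lim L D r \<phi> \<inter> net_lim L D r \<psi> \<subseteq> net_lim L D r \<rho>"
      using sup p unfolding net_lim_def by (meson order_trans)
  qed
qed

lemma centered_any_index:
  assumes "centered X L" "x \<in> X" "directed_on D r" "\<forall>d\<in>D. \<phi> d = x"
  shows "x \<in> net_lim L D r \<phi>"
proof -
  have const: "tail_filter D r \<phi> = principal {x}"
  proof -
    have ne: "D \<noteq> {}" and refl: "\<forall>a\<in>D. (a, a) \<in> r"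
      using assms(3) by (auto simp: directed_on_def preorder_on_def refl_on_def)
    have "tail D r \<phi> a = {x}" if "a \<in> D" for a
      using assms(4) refl that by (auto simp: tail_def image_iff)
    with ne show ?thesis by (simp add: tail_filter_def)
  qed
  define i :: "'a net_index" where "i = undefined"
  have dir: "directed_on {i} {(i, i)}"
    by (auto simp: directed_on_def preorder_on_def refl_on_def trans_def)
  then have "x \<in> net_lim L {i} {(i, i)} (\<lambda>_. x)"
    using assms(1,2) by (auto simp: centered_def)
  then have "x \<in> L (principal {x})"
    by (simp add: net_lim_def tail_filter_def tail_def)
  then show ?thesis
    by (simp add: net_lim_def const)
qed

lemma isotone_any_index:
  assumes "isotone X L" "net_in X D r \<phi>" "net_in X E s \<psi>"
    "tail_filter E s \<psi> \<le> tail_filter D r \<phi>"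
  shows "net_lim L D r \<phi> \<subseteq> net_lim L E s \<psi>"
  using assms tail_filter_proper unfolding isotone_iff_filter net_lim_def by metis

lemma stable_any_index:
  assumes "isotone X L" "stable X L" "net_in X D r \<phi>" "net_in X D r \<psi>" "net_in X D r \<rho>"
    "a \<in> D" "\<And>d. d \<in> D \<Longrightarrow> (a, d) \<in> r \<Longrightarrow> \<rho> d \<in> {\<phi> d, \<psi> d}"
  shows "net_lim L D r \<phi> \<inter> net_lim L D r \<psi> \<subseteq> net_lim L D r \<rho>"
proof -
  let ?F = "tail_filter D r \<phi>" and ?G = "tail_filter D r \<psi>"
  note p = tail_filter_proper[OF assms(3)] tail_filter_proper[OF assms(4)]
    tail_filter_proper[OF assms(5)]
  have "tail_filter D r \<rho> \<le> sup ?F ?G"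
    using tail_filter_le_sup[of D r a \<rho> \<phi> \<psi>] assms by (auto simp: net_in_def)
  then have "L (sup ?F ?G) \<subseteq> L (tail_filter D r \<rho>)"
    using assms(1) p unfolding isotone_iff_filter by (simp add: sup_eq_bot_iff)
  moreover have "L ?F \<inter> L ?G \<subseteq> L (sup ?F ?G)"
    using assms(2) p stable_iff_filter[OF assms(1)] by simp
  ultimately show ?thesis unfolding net_lim_def by (rule order_trans[rotated])
qed

lemma lim_continuous_any_index:
  assumes "lim_continuous X L Y M f" "net_in X D r \<phi>" "x \<in> X" "x \<in> net_lim L D r \<phi>"
  shows "f x \<in> net_lim M D r (f \<circ> \<phi>)"
proof -
  obtain E s and \<psi> :: "'a net_index \<Rightarrow> 'a"
    where \<psi>: "net_in X E s \<psi>" "tail_filter E s \<psi> = tail_filter D r \<phi>"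
    using ex_net_of_filter[OF tail_filter_proper[OF assms(2)]] .
  have "x \<in> net_lim L E s \<psi>"
    using assms(4) \<psi>(2) by (simp add: net_lim_def)
  then have "f x \<in> net_lim M E s (f \<circ> \<psi>)"
    using assms(1,3) \<psi>(1) by (simp add: lim_continuous_def)
  then show ?thesis
    using \<psi> assms(2) by (simp add: net_lim_def tail_filter_comp net_in_def)
qed

lemma lim_open_any_index:
  assumes "lim_open X L U" "net_in X D r \<phi>" "x \<in> U" "x \<in> net_lim L D r \<phi>"
  shows "\<exists>a\<in>D. tail D r \<phi> a \<subseteq> U"
proof -
  obtain E s and \<psi> :: "'a net_index \<Rightarrow> 'a"
    where \<psi>: "net_in X E s \<psi>" "tail_filter E s \<psi> = tail_filter D r \<phi>"
    using ex_net_of_filter[OF tail_filter_proper[OF assms(2)]] .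
  have "x \<in> net_lim L E s \<psi>"
    using assms(4) \<psi>(2) by (simp add: net_lim_def)
  then have "\<exists>a\<in>E. tail E s \<psi> a \<subseteq> U"
    using assms(1,3) \<psi>(1) unfolding lim_open_def by blast
  then have "eventually (\<lambda>x. x \<in> U) (tail_filter E s \<psi>)"
    using \<psi>(1) by (auto simp: eventually_tail_filter net_in_def)
  then show ?thesis
    using \<psi>(2) assms(2) by (auto simp: eventually_tail_filter net_in_def)
qed

end

theory Submission
  imports Defs
begin

text \<open>
  If \<open>F\<close> converges to \<open>x\<close>, then \<open>F\<close> contains an open set \<open>U\<close> around \<open>x\<close> meeting only finitely many
  members of the cover, and it contains the complement of each of these members that misses \<open>x\<close>,
  as the members are closed. So \<open>F\<close> contains the union of finitely many members \<open>C\<close> with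
  \<open>x \<in> C\<close>. The traces of \<open>F\<close> on these members are finer than \<open>F\<close>, hence converge to \<open>x\<close>, so their
  images under \<open>f\<close> converge to \<open>f x\<close>; by stability so does the intersection of the images, which
  is the image of \<open>F\<close>.
\<close>

text \<open>Every proper filter is the tail filter of some net, so conditions on nets carry over to
  filters. Filters suit the argument better: a trace on a subset is just an \<open>inf\<close> with
  a principal filter.\<close>

lemma lim_open_filter:
  assumes "lim_open X L U" "F \<noteq> bot" "F \<le> principal X" "x \<in> U" "x \<in> L F"
  shows "F \<le> principal U"
proof -
  obtain D r and \<phi> :: "'a net_index \<Rightarrow> 'a" where \<phi>: "net_in X D r \<phi>" "tail_filter D r \<phi> = F"
    using ex_net_of_filter[OF assms(2,3)] .
  have "\<exists>a\<in>D. tail D r \<phi> a \<subseteq> U"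
    using lim_open_any_index[OF assms(1) \<phi>(1) assms(4)] assms(5) \<phi>(2) by (simp add: net_lim_def)
  then have "eventually (\<lambda>y. y \<in> U) (tail_filter D r \<phi>)"
    using \<phi>(1) by (auto simp: eventually_tail_filter net_in_def)
  then show ?thesis
    by (simp add: \<phi>(2) le_principal)
qed

lemma lim_continuous_filter:
  assumes "lim_continuous X L Y M f" "F \<noteq> bot" "F \<le> principal X" "x \<in> X" "x \<in> L F"
  shows "f x \<in> M (filtermap f F)"
proof -
  obtain D r and \<phi> :: "'a net_index \<Rightarrow> 'a" where \<phi>: "net_in X D r \<phi>" "tail_filter D r \<phi> = F"
    using ex_net_of_filter[OF assms(2,3)] .
  have "f x \<in> net_lim M D r (f \<circ> \<phi>)"
    using lim_continuous_any_index[OF assms(1) \<phi>(1) assms(4)] assms(5) \<phi>(2)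
    by (simp add: net_lim_def)
  then show ?thesis
    using \<phi> by (simp add: net_lim_def tail_filter_comp net_in_def)
qed

text \<open>The way back to nets: tail filters are proper, and \<open>tail_filter_comp\<close> turns
  composition with \<open>f\<close> into \<open>filtermap f\<close>.\<close>

lemma lim_continuousI_filter:
  assumes "f \<in> X \<rightarrow> Y"
    and "\<And>F x. F \<noteq> bot \<Longrightarrow> F \<le> principal X \<Longrightarrow> x \<in> X \<Longrightarrow> x \<in> L F \<Longrightarrow> f x \<in> M (filtermap f F)"
  shows "lim_continuous X L Y M f"
  unfolding lim_continuous_def
proof (intro conjI allI ballI impI assms(1), elim conjE)
  fix D r x and \<phi> :: "'a net_index \<Rightarrow> 'a"
  assume "x \<in> X" "net_in X D r \<phi>" "x \<in> net_lim L D r \<phi>"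
  then show "f x \<in> net_lim M D r (f \<circ> \<phi>)"
    using assms(2)[OF tail_filter_proper] by (simp add: net_lim_def tail_filter_comp net_in_def)
qed

lemma limit_space_isotone:
  assumes "limit_space X L" "F \<le> principal X" "G \<noteq> bot" "G \<le> F"
  shows "L F \<subseteq> L G"
proof -
  have "F \<noteq> bot"
    using assms(3,4) by (auto simp: bot_unique)
  then show ?thesis
    using assms by (simp add: limit_space_def isotone_iff_filter)
qed

lemma limit_space_sup:
  assumes "limit_space X L" "F \<noteq> bot" "F \<le> principal X" "G \<noteq> bot" "G \<le> principal X"
  shows "L F \<inter> L G \<subseteq> L (sup F G)"
  using assms stable_iff_filter[of X L] by (simp add: limit_space_def)

lemma filtermap_le_principal:
  assumes "f \<in> X \<rightarrow> Y" "F \<le> principal X"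
  shows "filtermap f F \<le> principal Y"
  using assms by (auto simp: le_principal eventually_filtermap elim!: eventually_mono)

text \<open>Stability joins two filters at a time, hence the induction on \<open>\<D>\<close>.
  Traces may be improper, so convergence is asked only of those other than \<open>bot\<close>; for
  empty \<open>\<D>\<close> the last premise fails.\<close>

lemma lim_filtermap_finite_Union:
  assumes M: "limit_space Y M" and f: "f \<in> X \<rightarrow> Y" and F: "F \<le> principal X"
    and "finite \<D>"
    and "\<And>C. C \<in> \<D> \<Longrightarrow> inf F (principal C) \<noteq> bot \<Longrightarrow> y \<in> M (filtermap f (inf F (principal C)))"
    and "inf F (principal (\<Union>\<D>)) \<noteq> bot"
  shows "y \<in> M (filtermap f (inf F (principal (\<Union>\<D>))))"
  using assms(4-)
proof (induction \<D>)
  case (insert C \<D>)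
  let ?G = "inf F (principal C)" and ?H = "inf F (principal (\<Union>\<D>))"
  have split: "inf F (principal (\<Union>(insert C \<D>))) = sup ?G ?H"
    by (simp flip: sup_principal inf_sup_distrib1)
  have le: "filtermap f ?G \<le> principal Y" "filtermap f ?H \<le> principal Y"
    using F by (auto intro!: filtermap_le_principal[OF f] le_infI1)
  show ?case
  \<comment> \<open>If one trace is \<open>bot\<close>, the \<open>sup\<close> is the other trace,
    which is then proper and already handled; stability applies only to two proper filters.\<close>
  proof (cases "?G = bot \<or> ?H = bot")
    case True
    then show ?thesis
      using insert.IH insert.prems unfolding split by auto
  next
    case False
    then have "y \<in> M (filtermap f ?G) \<inter> M (filtermap f ?H)"
      using insert.IH insert.prems by auto
    then show ?thesis
      using limit_space_sup[OF M _ le(1) _ le(2)] False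
      unfolding split filtermap_sup by (auto simp: filtermap_bot_iff)
  qed
qed simp

theorem lemma3p2:
  fixes X :: "'a set" and L :: "'a filter \<Rightarrow> 'a set"
    and Y :: "'b set" and M :: "'b filter \<Rightarrow> 'b set"
    and f :: "'a \<Rightarrow> 'b" and \<C> :: "'a set set"
  assumes "limit_space X L" and "limit_space Y M"
    and "f \<in> X \<rightarrow> Y"
    and "lim_locally_finite X L \<C>" and "\<Union>\<C> = X"
    and "\<And>C. C \<in> \<C> \<Longrightarrow> lim_closed X L C"
    and "\<And>C. C \<in> \<C> \<Longrightarrow> lim_continuous C (subspace_conv C L) Y M (restrict f C)"
  shows "lim_continuous X L Y M f"
proof (rule lim_continuousI_filter)
  fix F x
  assume F: "F \<noteq> bot" "F \<le> principal X" and x: "x \<in> X" "x \<in> L F"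
  obtain U where U: "lim_open X L U" "x \<in> U" "finite {C \<in> \<C>. C \<inter> U \<noteq> {}}"
    using assms(4) x(1) by (auto simp: lim_locally_finite_def)
  define \<D> where "\<D> = {C \<in> \<C>. C \<inter> U \<noteq> {} \<and> x \<in> C}"
  have "finite \<D>"
    by (rule finite_subset[OF _ U(3)]) (auto simp: \<D>_def)
  have "eventually (\<lambda>z. z \<notin> C) F" if "C \<in> \<C>" "x \<notin> C" for C
  proof -
    have "F \<le> principal (X - C)"
      using lim_open_filter[of X L "X - C" F x] assms(6)[OF that(1)] F x that(2)
      by (simp add: lim_closed_def)
    then show ?thesis
      by (auto simp: le_principal elim: eventually_mono)
  qed
  \<comment> \<open>Local finiteness enters here: a filter is closed only under finite
    intersections.\<close>
  then have "eventually (\<lambda>z. \<forall>C\<in>{C \<in> \<C>. C \<inter> U \<noteq> {}} - \<D>. z \<notin> C) F"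
    using U(3) by (intro eventually_ball_finite) (auto simp: \<D>_def)
  moreover have "eventually (\<lambda>z. z \<in> X) F"
    using F(2) by (simp add: le_principal)
  moreover have "eventually (\<lambda>z. z \<in> U) F"
    using lim_open_filter[OF U(1) F U(2) x(2)] by (simp add: le_principal)
  ultimately have "eventually (\<lambda>z. z \<in> \<Union>\<D>) F"
    \<comment> \<open>Such a \<open>z\<close> lies in some \<open>C\<close> of the cover;
      \<open>C\<close> meets \<open>U\<close> in \<open>z\<close>, so it must belong to
      \<open>\<D>\<close>.\<close>
    by eventually_elim (use assms(5) in blast)
  then have F_eq: "inf F (principal (\<Union>\<D>)) = F"
    by (simp add: inf_absorb1 le_principal)
  have "f x \<in> M (filtermap f (inf F (principal C)))"
    if C: "C \<in> \<D>" and ne: "inf F (principal C) \<noteq> bot" for C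
  proof -
    let ?G = "inf F (principal C)"
    have C': "C \<in> \<C>" "x \<in> C"
      using C by (auto simp: \<D>_def)
    have "x \<in> L ?G"
      using limit_space_isotone[OF assms(1) F(2) ne] x(2) by auto
    then have "restrict f C x \<in> M (filtermap (restrict f C) ?G)"
      using lim_continuous_filter[OF assms(7)[OF C'(1)] ne] C'(2)
      by (simp add: subspace_conv_def)
    \<comment> \<open>Outside \<open>C\<close> the restriction is \<open>undefined\<close>, but
      \<open>?G\<close> contains \<open>C\<close>, and an image filter depends only on the values on
      a member of the filter.\<close>
    moreover have "filtermap (restrict f C) ?G = filtermap f ?G"
      by (auto simp: filter_eq_iff eventually_filtermap eventually_inf_principal
          elim!: eventually_mono)
    ultimately show ?thesis
      using C'(2) by simp
  qed
  then show "f x \<in> M (filtermap f F)"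
    using lim_filtermap_finite_Union[OF assms(2,3) F(2) \<open>finite \<D>\<close>] F(1) F_eq by metis
qed (fact assms(3))

end
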